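(* Let $X$ be a cellular complex with cell set $\mathcal{C}$ and face adjacency, whose adjacency graph is connected. If the adjacency graph is locally finite, then for every two cells $u,v\in\mathcal{C}$ there exists a path from $u$ to $v$ attaining $d_h(u,v)$, where $d_h$ is the count distance. In particular $(\mathcal{C},d_h)$ is a geodesic metric space (in the discrete sense that every pair of cells is joined by a path of adjacent cells whose length equals their distance).
   Context: The adjacency graph of a cellular complex has the cells as vertices and an edge between two cells when they are adjacent across a common face. It is locally finite if every cell has finitely many adjacent cells. A path from $u$ to $v$ is a finite sequence of successively adjacent cells $u=c_0\to c_1\to\cdots\to c_k=v$, and its length is the number of face crossings $L(\gamma)=k$. The count distance is $d_h(u,v):=\min_{\gamma:u\rightsquigarrow v}L(\gamma)$, the fewest crossings needed to connect $u$ to $v$; it is an integer-valued metric. *)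

theory Defs
  imports "HOL-Analysis.Abstract_Metric_Spaces"
begin

text \<open>
  A cellular complex enters only through its cells, its faces, and which faces belong to which
  cells. This covers, among others, polyhedral and regular CW complexes (top-dimensional cells with
  their codimension-one faces) and tessellations; neither the cell set nor the boundary of
  a single cell is assumed to be finite.
\<close>

record ('c, 'f) cell_structure =
  cells :: "'c set"
  faces :: "'f set"
  incident :: "'f \<Rightarrow> 'c \<Rightarrow> bool"

definition cellular_complex :: "('c, 'f) cell_structure \<Rightarrow> bool" where
  "cellular_complex X \<longleftrightarrow> (\<forall>f c. incident X f c \<longrightarrow> f \<in> faces X \<and> c \<in> cells X)"

definition adjacent :: "('c, 'f) cell_structure \<Rightarrow> 'c \<Rightarrow> 'c \<Rightarrow> bool" where
  "adjacent X c d \<longleftrightarrow> c \<in> cells X \<and> d \<in> cells X \<and> c \<noteq> d \<and>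
     (\<exists>f \<in> faces X. incident X f c \<and> incident X f d)"

definition locally_finite_adjacency :: "('c, 'f) cell_structure \<Rightarrow> bool" where
  "locally_finite_adjacency X \<longleftrightarrow> (\<forall>c \<in> cells X. finite {d. adjacent X c d})"

text \<open>A path \<open>c\<^sub>0 \<rightarrow> \<dots> \<rightarrow> c\<^sub>k\<close> is the list of its \<open>k + 1\<close> cells.\<close>

definition cell_path :: "('c, 'f) cell_structure \<Rightarrow> 'c \<Rightarrow> 'c \<Rightarrow> 'c list \<Rightarrow> bool" where
  "cell_path X u v p \<longleftrightarrow> p \<noteq> [] \<and> hd p = u \<and> last p = v \<and> set p \<subseteq> cells X \<and>
     successively (adjacent X) p"

definition crossings :: "'c list \<Rightarrow> nat" where
  "crossings p = length p - 1"

definition connected_adjacency :: "('c, 'f) cell_structure \<Rightarrow> bool" where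
  "connected_adjacency X \<longleftrightarrow> (\<forall>u \<in> cells X. \<forall>v \<in> cells X. \<exists>p. cell_path X u v p)"

text \<open>
  The infimum of a nonempty set of naturals is its minimum. For cells not joined by a path
  the value is the junk value \<open>Inf {} = 0\<close>; this is excluded by connectedness.
\<close>

definition count_dist :: "('c, 'f) cell_structure \<Rightarrow> 'c \<Rightarrow> 'c \<Rightarrow> nat" where
  "count_dist X u v = Inf {crossings p | p. cell_path X u v p}"

definition discrete_geodesic_metric ::
    "('c, 'f) cell_structure \<Rightarrow> ('c \<Rightarrow> 'c \<Rightarrow> real) \<Rightarrow> bool" where
  "discrete_geodesic_metric X d \<longleftrightarrow> Metric_space (cells X) d \<and>
     (\<forall>u \<in> cells X. \<forall>v \<in> cells X. \<exists>p. cell_path X u v p \<and> real (crossings p) = d u v)"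

end

theory Submission
  imports Defs
begin

text \<open>
  Lengths of paths are natural numbers, and a nonempty set of natural numbers contains its infimum.
  Connectedness makes the set of lengths nonempty, so some path realises the count distance
  (\<open>shortest_path_exists\<close>). The metric axioms come from operations on paths:
  reversal gives symmetry (\<open>cell_path_rev\<close>), concatenation of shortest paths gives the triangle
  inequality (\<open>cell_path_concat\<close>), and a path with no crossing stays in one cell, which
  separates distinct cells. A shortest path is then exactly the discrete geodesic asked for.
\<close>

lemma adjacent_commute: "adjacent X c d \<longleftrightarrow> adjacent X d c"
  unfolding adjacent_def by auto

lemma cell_path_singleton: "u \<in> cells X \<Longrightarrow> cell_path X u u [u]"
  by (simp add: cell_path_def)

lemma cell_path_rev:
  assumes "cell_path X u v p"
  shows "cell_path X v u (rev p)"
proof -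
  have "(\<lambda>x y. adjacent X y x) = adjacent X"
    by (intro ext) (rule adjacent_commute)
  then have "successively (adjacent X) (rev p) \<longleftrightarrow> successively (adjacent X) p"
    by (simp only: successively_rev)
  then show ?thesis
    using assms by (simp add: cell_path_def hd_rev last_rev del: successively_rev)
qed

text \<open>
  The first path ends in the cell where the second starts; dropping one of the two
  copies of this cell is what makes crossings add up exactly.
\<close>

lemma cell_path_concat:
  assumes "cell_path X u v p" and "cell_path X v w q"
  shows "cell_path X u w (p @ tl q)"
    and "crossings (p @ tl q) = crossings p + crossings q"
proof -
  obtain q' where q: "q = v # q'"
    using assms(2) by (cases q) (auto simp: cell_path_def)
  show "cell_path X u w (p @ tl q)"
    using assms unfolding q
    by (cases q') (auto simp: cell_path_def successively_append_iff)
  show "crossings (p @ tl q) = crossings p + crossings q"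
    using assms(1) unfolding q by (cases p) (auto simp: cell_path_def crossings_def)
qed

lemma cell_path_no_crossing:
  assumes "cell_path X u v p" and "crossings p = 0"
  shows "u = v"
  using assms by (cases p) (auto simp: cell_path_def crossings_def)

lemma count_dist_le: "cell_path X u v p \<Longrightarrow> count_dist X u v \<le> crossings p"
  unfolding count_dist_def by (intro cInf_lower) auto

lemma shortest_path_exists:
  assumes "cell_path X u v q"
  obtains p where "cell_path X u v p" and "crossings p = count_dist X u v"
proof -
  have "Inf {crossings p | p. cell_path X u v p} \<in> {crossings p | p. cell_path X u v p}"
    using assms by (intro Inf_nat_def1) auto
  then show ?thesis
    using that unfolding count_dist_def by auto
qed

text \<open>
  Both sides are infima of the same set of lengths, since reversal exchanges paths
  from \<open>u\<close> to \<open>v\<close> with paths back. This form covers points outside the complex as well, for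
  which the locale \<^locale>\<open>Metric_space\<close> also demands symmetry.
\<close>

lemma count_dist_commute: "count_dist X u v = count_dist X v u"
proof -
  have "{crossings p | p. cell_path X a b p} \<subseteq> {crossings p | p. cell_path X b a p}" for a b
  proof clarify
    fix p assume "cell_path X a b p"
    then have "cell_path X b a (rev p)" by (rule cell_path_rev)
    then show "\<exists>p'. crossings p = crossings p' \<and> cell_path X b a p'"
      by (intro exI[of _ "rev p"]) (simp add: crossings_def)
  qed
  then have "{crossings p | p. cell_path X u v p} = {crossings p | p. cell_path X v u p}"
    by (intro equalityI)
  then show ?thesis
    by (simp only: count_dist_def)
qed

lemma count_dist_self:
  assumes "u \<in> cells X"
  shows "count_dist X u u = 0"
  using count_dist_le[OF cell_path_singleton[OF assms]] by (simp add: crossings_def)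

lemma count_dist_eq_0D:
  assumes "cell_path X u v q" and "count_dist X u v = 0"
  shows "u = v"
  using assms by (metis shortest_path_exists cell_path_no_crossing)

lemma count_dist_triangle:
  assumes "cell_path X u v p" and "cell_path X v w q"
  shows "count_dist X u w \<le> count_dist X u v + count_dist X v w"
proof -
  obtain p' where p': "cell_path X u v p'" "crossings p' = count_dist X u v"
    using assms(1) by (rule shortest_path_exists)
  obtain q' where q': "cell_path X v w q'" "crossings q' = count_dist X v w"
    using assms(2) by (rule shortest_path_exists)
  show ?thesis
    using count_dist_le[OF cell_path_concat(1)[OF p'(1) q'(1)]]
      cell_path_concat(2)[OF p'(1) q'(1)] p'(2) q'(2)
    by simp
qed

lemma Metric_space_count_dist:
  assumes "connected_adjacency X"
  shows "Metric_space (cells X) (\<lambda>u v. real (count_dist X u v))"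
proof
  have path: "\<exists>p. cell_path X u v p" if "u \<in> cells X" "v \<in> cells X" for u v
    using assms that by (simp add: connected_adjacency_def)
  show "0 \<le> real (count_dist X u v)" for u v
    by simp
  show "real (count_dist X u v) = real (count_dist X v u)" for u v
    by (subst count_dist_commute) (rule refl)
  show "real (count_dist X u v) = 0 \<longleftrightarrow> u = v" if "u \<in> cells X" "v \<in> cells X" for u v
    using path[OF that] count_dist_eq_0D count_dist_self[OF that(1)] by auto
  show "real (count_dist X u w) \<le> real (count_dist X u v) + real (count_dist X v w)"
    if "u \<in> cells X" "v \<in> cells X" "w \<in> cells X" for u v w
    using path[OF that(1,2)] path[OF that(2,3)] count_dist_triangle
    by (metis of_nat_add of_nat_mono)
qed

theorem theorem2p1:
  fixes X :: "('c, 'f) cell_structure"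
  assumes "cellular_complex X"
    and "connected_adjacency X"
    and "locally_finite_adjacency X"
  shows "(\<forall>u \<in> cells X. \<forall>v \<in> cells X. \<exists>p. cell_path X u v p \<and> crossings p = count_dist X u v)
    \<and> discrete_geodesic_metric X (\<lambda>u v. real (count_dist X u v))"
proof -
  have geodesic: "\<exists>p. cell_path X u v p \<and> crossings p = count_dist X u v"
    if "u \<in> cells X" "v \<in> cells X" for u v
    using assms(2) that shortest_path_exists unfolding connected_adjacency_def by metis
  then show ?thesis
    using Metric_space_count_dist[OF assms(2)] by (simp add: discrete_geodesic_metric_def)
qed

end
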